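(* There exists a constant $C > 1$ such that the following holds. Let $k$ and $N$ be positive integers satisfying $k \le (\log N)^2$. Setting $$\varepsilon_k^H(N) = \bigg| N H_k(N) - \sum_{j=1}^k \binom{k}{j} \varphi_j (\log N)^{k-j} \bigg|; \qquad \varepsilon_k^Z(N) = \bigg| N Z_k(N) - \sum_{j=1}^k \binom{k}{j} \varphi_j (\log N + \log 2)^{k-j} \bigg|,$$ we have $$\varepsilon_k^H(N) \le C\, 2^k k!\, (\log N)^{14} N^{-1/2}; \qquad \varepsilon_k^Z(N) \le C\, 2^k k!\, (\log N)^{14} N^{-1/2}.$$
   Context: For integers $m \ge k \ge 1$, let $\mathcal{C}_k(m)$ be the set of $k$-tuples $\mathbf{a} = (a_1, \ldots, a_k)$ of positive integers with $\sum_i a_i = m$, and define $$H_k(m) = \sum_{\mathbf{a} \in \mathcal{C}_k(m)} \prod_{i=1}^k \frac{1}{a_i}; \qquad Z_k(m) = \sum_{\mathbf{a} \in \mathcal{C}_k(m)} \prod_{i=1}^k \frac{\zeta(2a_i)}{a_i},$$ where $\zeta$ is the Riemann zeta function. For each integer $j \ge 0$ define $$\varphi_j = \frac{1}{\pi} \frac{\partial^j}{\partial s^j} \big( \Gamma(1-s) \sin(\pi s) \big) \Big|_{s=0}.$$ *)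

theory Defs
  imports "HOL-Analysis.Analysis"
begin

(* Lists serve as k-tuples, so the i-th entry (counting from 0) is a ! i. *)
definition compositions :: "nat \<Rightarrow> nat \<Rightarrow> nat list set" where
  "compositions k m = {a. length a = k \<and> (\<forall>i<k. a ! i > 0) \<and> (\<Sum>i<k. a ! i) = m}"

(* Sums over an infinite set are 0 by convention, so finiteness is recorded here. *)
lemma finite_compositions: "finite (compositions k m)"
proof (rule finite_subset)
  show "compositions k m \<subseteq> {a. set a \<subseteq> {..m} \<and> length a = k}"
  proof
    fix a assume a: "a \<in> compositions k m"
    have "a ! i \<le> m" if "i < k" for i
    proof -
      have "a ! i \<le> (\<Sum>i<k. a ! i)"
        using that by (intro member_le_sum) auto
      with a show ?thesis by (simp add: compositions_def)
    qed
    with a show "a \<in> {a. set a \<subseteq> {..m} \<and> length a = k}"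
      by (auto simp: compositions_def in_set_conv_nth)
  qed
  show "finite {a. set a \<subseteq> {..m} \<and> length a = k}"
    by (rule finite_lists_length_eq) simp
qed

(* The Riemann zeta function on real s > 1, by its Dirichlet series. It is only
   evaluated at s = 2 a with a a positive integer; no continuation is needed. *)
definition zeta :: "real \<Rightarrow> real" where
  "zeta s = (\<Sum>n. 1 / real (Suc n) powr s)"

definition H :: "nat \<Rightarrow> nat \<Rightarrow> real" where
  "H k m = (\<Sum>a\<in>compositions k m. \<Prod>i<k. 1 / real (a ! i))"

definition Z :: "nat \<Rightarrow> nat \<Rightarrow> real" where
  "Z k m = (\<Sum>a\<in>compositions k m. \<Prod>i<k. zeta (2 * real (a ! i)) / real (a ! i))"

(* The derivatives are those of a function of a real variable, smooth on s < 1. *)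
definition phi :: "nat \<Rightarrow> real" where
  "phi j = 1 / pi * (deriv ^^ j) (\<lambda>s::real. Gamma (1 - s) * sin (pi * s)) 0"

definition eps_H :: "nat \<Rightarrow> nat \<Rightarrow> real" where
  "eps_H k N = \<bar>real N * H k N
     - (\<Sum>j=1..k. real (k choose j) * phi j * ln (real N) ^ (k - j))\<bar>"

definition eps_Z :: "nat \<Rightarrow> nat \<Rightarrow> real" where
  "eps_Z k N = \<bar>real N * Z k N
     - (\<Sum>j=1..k. real (k choose j) * phi j * (ln (real N) + ln 2) ^ (k - j))\<bar>"

end

theory Submission
  imports Defs "HOL-Complex_Analysis.Complex_Analysis"
begin

text \<open>
  The power series of $1/a$ and of $\zeta(2a)/a$ have the form $F = L + G$ with $L(x) = -\log(1-x)$
  and $G$ analytic on a disc of radius greater than $2$ ($G = 0$ for $H$, and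
  $G(1) = \sum_a (\zeta(2a)-1)/a = \log 2$ for $Z$). Since $\exp(sF) = (1-x)^{-s} \exp(sG)$, the
  coefficient of $x^N$ in $\exp(sF)$, times $N$, is $(N e^{G(1)})^s / \Gamma(s) + O(N^{-1/2})$
  uniformly on $|s| \le 1/2$. By the reflection formula $\varphi_j$ is the $j$-th derivative of
  $1/\Gamma$ at $0$, so the errors in question are the $k$-th derivatives at $s = 0$ of this
  difference, and Cauchy's inequality on $|s| = 1/2$ bounds them by $O(2^k k! N^{-1/2})$.
\<close>

subsection \<open>Asymptotics of the binomial coefficients\<close>

lemma norm_exp_minus_one_le:
  fixes z :: complex
  assumes "norm z \<le> 1 / 2"
  shows "norm (exp z - 1) \<le> 2 * norm z"
proof -
  have "norm (exp z - exp 0) \<le> 2 * norm (z - 0)"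
  proof (rule field_differentiable_bound[where S = "cball 0 (1/2)" and f' = exp])
    show "norm (exp w) \<le> 2" if "w \<in> cball 0 (1/2)" for w :: complex
      using that by (intro exp_bound_half) simp
  qed (use assms in \<open>auto intro!: derivative_eq_intros\<close>)
  thus ?thesis by simp
qed

lemma norm_exp_mult_ln_le:
  fixes s :: complex
  assumes "norm s \<le> 1 / 2" "x \<ge> 1"
  shows "norm (exp (s * of_real (ln x))) \<le> sqrt x"
proof -
  have "Re s * ln x \<le> 1 / 2 * ln x"
    using assms complex_Re_le_cmod[of s] by (intro mult_right_mono) auto
  hence "norm (exp (s * of_real (ln x))) \<le> exp (1 / 2 * ln x)"
    by simp
  also have "\<dots> = sqrt x"
    using assms by (simp flip: powr_half_sqrt add: powr_def)
  finally show ?thesis .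
qed

text \<open>The function (1 + s z)(1 + z)^(-s) has derivative s (1 - s) z (1 + z)^(-s-1): the
  first-order terms cancel, which leaves an error quadratic in t. The factor 3/4 is the bound 1/2 *
  3/2 for |s| |1 - s|.\<close>

lemma norm_linear_times_power_minus_one_le:
  fixes s :: complex and t :: real
  assumes s: "norm s \<le> 1 / 2" and t: "t \<ge> 0"
  shows "norm ((1 + s * of_real t) * exp (- s * of_real (ln (1 + t))) - 1) \<le> 3 / 4 * t\<^sup>2"
proof -
  define f where "f = (\<lambda>z. (1 + s * z) * exp (- s * Ln (1 + z)))"
  define f' where "f' = (\<lambda>z. s * (1 - s) * z / (1 + z) * exp (- s * Ln (1 + z)))"
  \<comment> \<open>The mean value inequality is applied on the real segment, where
    \<open>Ln (1 + z)\<close> is a real logarithm and \<open>norm_exp_mult_ln_le\<close>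
    applies.\<close>
  let ?S = "of_real ` {0..t} :: complex set"
  have pos: "1 + complex_of_real u \<notin> \<real>\<^sub>\<le>\<^sub>0" "1 + complex_of_real u \<noteq> 0" if "u \<ge> 0" for u
  proof -
    have "1 + complex_of_real u = of_real (1 + u)" by simp
    thus "1 + complex_of_real u \<notin> \<real>\<^sub>\<le>\<^sub>0" using that by (simp del: of_real_add add: complex_nonpos_Reals_iff)
    thus "1 + complex_of_real u \<noteq> 0" by auto
  qed
  have "norm (f (of_real t) - f 0) \<le> 3 / 4 * t * norm (of_real t - 0 :: complex)"
  proof (rule field_differentiable_bound[where S = ?S and f' = f'])
    show "convex ?S"
      by (intro convex_linear_image) (auto intro: bounded_linear.linear bounded_linear_of_real)
  next
    fix z assume "z \<in> ?S"
    then obtain u where u: "u \<ge> 0" "u \<le> t" "z = of_real u" by auto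
    show "(f has_field_derivative f' z) (at z within ?S)"
      unfolding f_def f'_def using pos[OF u(1)] u(3)
      by (auto intro!: derivative_eq_intros simp: divide_simps)
         (auto simp: algebra_simps)
    have "Ln (1 + z) = of_real (ln (1 + u))"
      using u by (metis Ln_of_real add_nonneg_pos add.commute of_real_1 of_real_add zero_less_one)
    hence "norm (exp (- s * Ln (1 + z))) \<le> sqrt (1 + u)"
      using norm_exp_mult_ln_le[of "-s" "1 + u"] s u by simp
    \<comment> \<open>This cancels the denominator 1 + u in the derivative.\<close>
    also have "\<dots> \<le> 1 + u"
      using u by (intro real_le_lsqrt) (auto simp: power2_eq_square algebra_simps)
    finally have 1: "norm (exp (- s * Ln (1 + z))) \<le> 1 + u" .
    have nz: "norm (1 + z) = 1 + u"
      using u by (metis abs_of_nonneg add_nonneg_nonneg norm_of_real of_real_1 of_real_add zero_le_one)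
    have "norm (1 - s) \<le> 3 / 2"
      using norm_triangle_ineq4[of 1 s] s by simp
    hence "norm s * norm (1 - s) \<le> 1 / 2 * (3 / 2)"
      using s by (intro mult_mono) auto
    moreover have "norm (f' z) = norm s * norm (1 - s) * u * (norm (exp (- s * Ln (1 + z))) / (1 + u))"
      unfolding f'_def norm_mult norm_divide nz using u by simp
    moreover have "norm (exp (- s * Ln (1 + z))) / (1 + u) \<le> 1"
      using 1 u by (simp add: divide_simps)
    moreover have "norm s * norm (1 - s) * u * (norm (exp (- s * Ln (1 + z))) / (1 + u))
                     \<le> 1 / 2 * (3 / 2) * t * 1"
      using u by (intro mult_mono calculation) auto
    ultimately have "norm (f' z) \<le> 1 / 2 * (3 / 2) * t * 1"
      by (simp only:)
    thus "norm (f' z) \<le> 3 / 4 * t" by simp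
  qed (use t in \<open>auto simp: image_iff intro!: bexI[of _ "0::real"]\<close>)
  moreover have "Ln (1 + of_real t) = of_real (ln (1 + t))"
    using t by (metis Ln_of_real add_nonneg_pos add.commute of_real_1 of_real_add zero_less_one)
  ultimately show ?thesis using t by (simp add: f_def power2_eq_square)
qed

text \<open>This is $n a_n n^{-s}$, where $a_n$ is the coefficient of $x^n$ in $(1-x)^{-s}$.\<close>
definition gamma_quotient :: "complex \<Rightarrow> nat \<Rightarrow> complex" where
  "gamma_quotient s n =
     of_nat n * (pochhammer s n / fact n) * exp (- s * of_real (ln (real n)))"

text \<open>Since a_(n+1) = a_n (s + n) / (n + 1), the ratio of consecutive values is the expression
  of \<open>norm_linear_times_power_minus_one_le\<close> at t = 1/n, hence 1 + O(1/n^2) for |s| <=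
  1/2.\<close>

lemma gamma_quotient_Suc:
  assumes "n > 0"
  shows "gamma_quotient s (Suc n) = gamma_quotient s n *
           ((1 + s * of_real (1 / real n)) * exp (- s * of_real (ln (1 + 1 / real n))))"
proof -
  have "real (Suc n) = real n * (1 + 1 / real n)"
    using assms by (simp add: field_simps)
  moreover have "0 < 1 + 1 / real n"
    by (simp add: add_pos_nonneg)
  ultimately have "ln (real (Suc n)) = ln (real n) + ln (1 + 1 / real n)"
    using assms by (simp only: ln_mult_pos of_nat_0_less_iff)
  hence "exp (- s * of_real (ln (real (Suc n)))) =
           exp (- s * of_real (ln (real n))) * exp (- s * of_real (ln (1 + 1 / real n)))"
    by (simp only: of_real_add distrib_left exp_add)
  moreover have "of_nat (Suc n) * (pochhammer s (Suc n) / fact (Suc n)) =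
                   of_nat n * (pochhammer s n / fact n) * (1 + s * of_real (1 / real n))"
  proof -
    have "of_nat (Suc n) * (pochhammer s (Suc n) / fact (Suc n)) = pochhammer s n * (s + of_nat n) / fact n"
      by (simp add: pochhammer_rec' field_simps del: of_nat_Suc)
    also have "s + of_nat n = of_nat n * (1 + s * of_real (1 / real n))"
      using assms by (simp add: field_simps)
    finally show ?thesis by simp
  qed
  ultimately show ?thesis
    unfolding gamma_quotient_def by (simp only: mult_ac)
qed

text \<open>The Pochhammer symbol in \<open>rGamma_series s n\<close> has one factor s + n more;
  dividing by s/n + 1, which tends to 1, turns that factor into n.\<close>

lemma gamma_quotient_LIMSEQ: "gamma_quotient s \<longlonglongrightarrow> rGamma s"
proof -
  have "rGamma_series s n * inverse (s / of_nat n + 1) = gamma_quotient s n"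
    if n: "n > norm s" for n
  proof -
    have "s + of_nat n \<noteq> 0"
      using n by (metis add_eq_0_iff less_irrefl norm_minus_cancel norm_of_nat)
    moreover have "n > 0"
      using n norm_ge_zero[of s] by linarith
    ultimately show ?thesis
      by (simp add: gamma_quotient_def rGamma_series_def pochhammer_rec' exp_minus divide_simps)
  qed
  moreover have "eventually (\<lambda>n. real n > norm s) sequentially"
    using filterlim_real_sequentially by (simp add: filterlim_at_top_dense)
  ultimately have "eventually (\<lambda>n. rGamma_series s n * inverse (s / of_nat n + 1) = gamma_quotient s n) sequentially"
    by (auto elim: eventually_mono)
  moreover have "(\<lambda>n. rGamma_series s n * inverse (s / of_nat n + 1)) \<longlonglongrightarrow> rGamma s * inverse (0 + 1)"
    by (intro tendsto_intros rGamma_series_LIMSEQ lim_const_over_n) auto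
  ultimately show ?thesis by (simp add: tendsto_cong)
qed

text \<open>From n + 1 <= 2n. A telescoping majorant turns the O(1/n^2) errors into closed bounds
  that can be carried through an induction.\<close>

lemma inverse_square_le_telescope:
  assumes "n > 0" "c \<ge> 0"
  shows "c * (1 / real n)\<^sup>2 \<le> 2 * c / real n - 2 * c / real (Suc n)"
proof -
  have "1 / real n - 1 / real (Suc n) = 1 / (real n * real (Suc n))"
    using assms by (simp add: divide_simps)
  moreover have "1 / (real n * real n) \<le> 1 / (real n * (real (Suc n) / 2))"
    using assms by (intro divide_left_mono mult_left_mono) auto
  ultimately have "(1 / real n)\<^sup>2 \<le> 2 * (1 / real n - 1 / real (Suc n))"
    by (simp add: power2_eq_square)
  hence "c * (1 / real n)\<^sup>2 \<le> c * (2 * (1 / real n - 1 / real (Suc n)))"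
    using assms by (intro mult_left_mono)
  thus ?thesis by (simp add: algebra_simps)
qed

text \<open>Each ratio is at most 1 + d <= exp d with d = 2/n - 2/(n+1), and these exponents
  telescope. The induction starts from the value at 1, which is s itself.\<close>

lemma norm_gamma_quotient_le:
  assumes s: "norm s \<le> 1 / 2" and "n > 0"
  shows "norm (gamma_quotient s n) \<le> exp (2 - 2 / real n)"
  using \<open>n > 0\<close>
proof (induction n rule: nat_induct_non_zero)
  case 1
  thus ?case using s by (simp add: gamma_quotient_def)
next
  case (Suc n)
  let ?r = "(1 + s * of_real (1 / real n)) * exp (- s * of_real (ln (1 + 1 / real n)))"
  have "norm ?r \<le> 1 + norm (?r - 1)"
    using norm_triangle_ineq2[of ?r 1] by simp
  also have "norm (?r - 1) \<le> 3 / 4 * (1 / real n)\<^sup>2"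
    by (rule norm_linear_times_power_minus_one_le) (use s in auto)
  also have "\<dots> \<le> 2 / real n - 2 / real (Suc n)"
    using inverse_square_le_telescope[OF Suc.hyps, of 1] zero_le_power2[of "1 / real n"] by linarith
  also have "1 + \<dots> \<le> exp (2 / real n - 2 / real (Suc n))"
    by (rule exp_ge_add_one_self)
  finally have "norm ?r \<le> exp (2 / real n - 2 / real (Suc n))" by simp
  hence "norm (gamma_quotient s (Suc n)) \<le> exp (2 - 2 / real n) * exp (2 / real n - 2 / real (Suc n))"
    unfolding gamma_quotient_Suc[OF Suc.hyps] norm_mult[of "gamma_quotient s n"]
    using Suc.IH by (intro mult_mono) auto
  also have "\<dots> = exp (2 - 2 / real (Suc n))"
    by (simp flip: exp_add)
  finally show ?case .
qed

lemma exp_2_le_8: "exp (2 :: real) \<le> 8"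
proof -
  have "exp 1 \<le> (272 / 100 :: real)" using e_less_272 by simp
  hence "exp 1 ^ 2 \<le> (272 / 100 :: real) ^ 2" by (intro power_mono) auto
  also have "\<dots> \<le> 8" by (simp add: power2_eq_square)
  finally show ?thesis by (simp flip: exp_of_nat_mult)
qed

lemma norm_gamma_quotient_le_8:
  assumes "norm s \<le> 1 / 2"
  shows "norm (gamma_quotient s n) \<le> 8"
proof (cases "n = 0")
  case False
  hence "norm (gamma_quotient s n) \<le> exp (2 - 2 / real n)"
    using assms by (intro norm_gamma_quotient_le) auto
  also have "\<dots> \<le> exp 2" by simp
  finally show ?thesis using exp_2_le_8 by linarith
qed (simp add: gamma_quotient_def)

lemma norm_rGamma_le:
  fixes s :: complex
  assumes "norm s \<le> 1 / 2"
  shows "norm (rGamma s) \<le> 8"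
  by (rule tendsto_upperbound[OF tendsto_norm[OF gamma_quotient_LIMSEQ]])
     (use norm_gamma_quotient_le_8[OF assms] in auto)

text \<open>The step from m to m + 1 changes the value by at most 8 * 3/4 / m^2, which is dominated
  by a telescoping difference. Summing from n on and passing to the limit gives the distance to
  \<open>rGamma s\<close>.\<close>

lemma norm_gamma_quotient_diff_le:
  assumes s: "norm s \<le> 1 / 2" and n: "n > 0"
  shows "norm (gamma_quotient s n - rGamma s) \<le> 16 / real n"
proof -
  have "norm (gamma_quotient s m - gamma_quotient s n) \<le> 16 / real n - 16 / real m" if "m \<ge> n" for m
    using that
  proof (induction m rule: dec_induct)
    case (step m)
    let ?r = "(1 + s * of_real (1 / real m)) * exp (- s * of_real (ln (1 + 1 / real m)))"
    have m: "m > 0" using step n by simp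
    have "norm (gamma_quotient s (Suc m) - gamma_quotient s m) = norm (gamma_quotient s m) * norm (?r - 1)"
      by (simp add: gamma_quotient_Suc[OF m] algebra_simps flip: norm_mult)
    also have "\<dots> \<le> 8 * (3 / 4 * (1 / real m)\<^sup>2)"
      by (intro mult_mono norm_gamma_quotient_le_8 norm_linear_times_power_minus_one_le s) auto
    also have "\<dots> \<le> 16 / real m - 16 / real (Suc m)"
      using inverse_square_le_telescope[OF m, of 8] zero_le_power2[of "1 / real m"] by linarith
    finally have "norm (gamma_quotient s (Suc m) - gamma_quotient s m) \<le> 16 / real m - 16 / real (Suc m)" .
    with step.IH show ?case
      using norm_triangle_ineq[of "gamma_quotient s (Suc m) - gamma_quotient s m"
              "gamma_quotient s m - gamma_quotient s n"] by simp
  qed simp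
  moreover have "16 / real n - 16 / real m \<le> 16 / real n" for m by simp
  ultimately have "norm (gamma_quotient s m - gamma_quotient s n) \<le> 16 / real n" if "m \<ge> n" for m
    using that order_trans by blast
  hence "eventually (\<lambda>m. norm (gamma_quotient s m - gamma_quotient s n) \<le> 16 / real n) sequentially"
    using eventually_ge_at_top by (rule eventually_mono[rotated])
  moreover have "(\<lambda>m. norm (gamma_quotient s m - gamma_quotient s n)) \<longlonglongrightarrow> norm (rGamma s - gamma_quotient s n)"
    by (intro tendsto_intros gamma_quotient_LIMSEQ)
  ultimately have "norm (rGamma s - gamma_quotient s n) \<le> 16 / real n"
    by (intro tendsto_upperbound) auto
  thus ?thesis by (simp add: norm_minus_commute)
qed

text \<open>Multiplying by n^s, whose norm is at most sqrt n, turns the error O(1/n) into O(1/sqrt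
  n).\<close>

lemma pochhammer_asymptotics:
  fixes s :: complex
  assumes s: "norm s \<le> 1 / 2" and n: "n > 0"
  shows "norm (of_nat n * (pochhammer s n / fact n) - rGamma s * exp (s * of_real (ln (real n))))
           \<le> 16 / sqrt (real n)"
proof -
  let ?e = "exp (s * of_real (ln (real n)))"
  have "of_nat n * (pochhammer s n / fact n) = gamma_quotient s n * ?e"
    by (simp add: gamma_quotient_def exp_minus)
  hence "norm (of_nat n * (pochhammer s n / fact n) - rGamma s * ?e)
           = norm (gamma_quotient s n - rGamma s) * norm ?e"
    by (simp only: norm_mult[symmetric] left_diff_distrib)
  also have "\<dots> \<le> 16 / real n * sqrt (real n)"
    using s n by (intro mult_mono norm_gamma_quotient_diff_le norm_exp_mult_ln_le) auto
  also have "\<dots> = 16 / sqrt (real n)"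
    using n by (simp add: field_simps)
  finally show ?thesis .
qed

text \<open>Each new factor (s + n)/(n + 1) has norm at most 1. This crude bound serves the shifts
  that exceed half the index.\<close>

lemma norm_pochhammer_le:
  fixes s :: complex
  assumes s: "norm s \<le> 1 / 2"
  shows "norm (pochhammer s n / fact n) \<le> 1"
  unfolding norm_divide norm_fact
proof (induction n)
  case (Suc n)
  have "norm (s + of_nat n) \<le> real (Suc n)"
    using norm_triangle_ineq[of s "of_nat n"] s by simp
  hence "norm (pochhammer s n) / fact n * norm (s + of_nat n) / real (Suc n) \<le> 1 * real (Suc n) / real (Suc n)"
    using Suc.IH by (intro divide_right_mono mult_mono) auto
  moreover have "norm (pochhammer s (Suc n)) / fact (Suc n) = norm (pochhammer s n) / fact n * norm (s + of_nat n) / real (Suc n)"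
    by (simp add: pochhammer_rec' norm_mult mult_ac)
  ultimately show ?case by simp
qed simp

subsection \<open>Exponentials of power series\<close>

text \<open>Division by zero gives 0, so the constant coefficient vanishes, as is wanted for
  composition with \<open>fps_exp\<close>.\<close>

definition log_fps :: "complex fps" where
  "log_fps = Abs_fps (\<lambda>n. 1 / of_nat n)"

lemma log_fps_nth_0 [simp]: "fps_nth log_fps 0 = 0"
  by (simp add: log_fps_def)

lemma eventually_norm_less_one: "eventually (\<lambda>u::complex. norm u < 1) (nhds 0)"
  using eventually_nhds_in_open[of "ball 0 1" "0::complex"] by simp

lemma has_fps_expansion_log: "(\<lambda>x. - Ln (1 - x)) has_fps_expansion log_fps"
proof (rule has_fps_expansionI)
  show "eventually (\<lambda>u. (\<lambda>n. fps_nth log_fps n * u ^ n) sums - Ln (1 - u)) (nhds 0)"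
    using eventually_norm_less_one
  proof eventually_elim
    case (elim u)
    hence "(\<lambda>n. - (u ^ n) / of_nat n) sums Ln (1 - u)"
      using Ln_series'[of "- u"] by simp
    from sums_minus[OF this] show ?case
      by (simp add: log_fps_def)
  qed
qed

text \<open>Both series expand (1 - x)^(-s) near 0: one as exp(-s log(1 - x)), the other by the
  binomial series.\<close>

lemma exp_compose_log_fps:
  "fps_exp s oo log_fps = Abs_fps (\<lambda>n. pochhammer s n / fact n)"
proof (rule fps_expansion_unique_complex)
  show "((\<lambda>x. exp (s * x)) \<circ> (\<lambda>x. - Ln (1 - x))) has_fps_expansion (fps_exp s oo log_fps)"
    by (intro has_fps_expansion_compose has_fps_expansion_exp has_fps_expansion_log) simp
  show "((\<lambda>x. exp (s * x)) \<circ> (\<lambda>x. - Ln (1 - x))) has_fps_expansion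
          Abs_fps (\<lambda>n. pochhammer s n / fact n)"
  proof (rule has_fps_expansionI)
    show "eventually (\<lambda>u. (\<lambda>n. fps_nth (Abs_fps (\<lambda>n. pochhammer s n / fact n)) n * u ^ n) sums
            ((\<lambda>x. exp (s * x)) \<circ> (\<lambda>x. - Ln (1 - x))) u) (nhds 0)"
      using eventually_norm_less_one
    proof eventually_elim
      case (elim u)
      hence "1 - u \<noteq> 0" by auto
      \<comment> \<open>The sign of the binomial coefficient of -s cancels that of (-u)^n.\<close>
      moreover have "((- s) gchoose n) * (- u) ^ n = pochhammer s n / fact n * u ^ n" for n
      proof -
        have "(- u) ^ n = (- 1) ^ n * u ^ n"
          by (rule power_minus)
        thus ?thesis
          by (simp add: gbinomial_pochhammer flip: power_mult_distrib)
      qed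
      ultimately show ?case
        using gen_binomial_complex[of "- u" "- s"] elim
        by (simp add: powr_def)
    qed
  qed
qed

text \<open>The functional equation exp(s(f + g)) = exp(sf) exp(sg) holds for the functions, and
  uniqueness of expansions transfers it to the formal series.\<close>

lemma exp_compose_add:
  fixes s :: complex
  assumes "f has_fps_expansion F" "g has_fps_expansion G" "fps_nth F 0 = 0" "fps_nth G 0 = 0"
  shows "fps_exp s oo (F + G) = (fps_exp s oo F) * (fps_exp s oo G)"
proof (rule fps_expansion_unique_complex)
  show "((\<lambda>x. exp (s * x)) \<circ> (\<lambda>x. f x + g x)) has_fps_expansion (fps_exp s oo (F + G))"
    using assms by (intro has_fps_expansion_compose has_fps_expansion_exp has_fps_expansion_add) simp_all
  have "(\<lambda>x. ((\<lambda>x. exp (s * x)) \<circ> f) x * ((\<lambda>x. exp (s * x)) \<circ> g) x) has_fps_expansion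
          (fps_exp s oo F) * (fps_exp s oo G)"
    using assms by (intro has_fps_expansion_mult has_fps_expansion_compose has_fps_expansion_exp)
  thus "((\<lambda>x. exp (s * x)) \<circ> (\<lambda>x. f x + g x)) has_fps_expansion (fps_exp s oo F) * (fps_exp s oo G)"
    by (simp add: o_def algebra_simps flip: exp_add)
qed

section \<open>Coefficients of exp(sF) as functions of s\<close>

lemma exp_compose_nth_sums:
  fixes F :: "complex fps"
  assumes "fps_nth F 0 = 0"
  shows "(\<lambda>i. fps_nth (F ^ i) n / fact i * s ^ i) sums fps_nth (fps_exp s oo F) n"
proof -
  \<comment> \<open>F^i has no terms below x^i, so for fixed n the coefficient is a polynomial in s
    of degree at most n.\<close>
  have "fps_nth (F ^ i) n = 0" if "i > n" for i
    using startsby_zero_power_prefix[OF assms] that by auto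
  hence "(\<lambda>i. fps_nth (F ^ i) n / fact i * s ^ i) sums (\<Sum>i\<in>{0..n}. fps_nth (F ^ i) n / fact i * s ^ i)"
    by (intro sums_finite) auto
  thus ?thesis by (simp add: fps_compose_nth mult_ac)
qed

text \<open>As exp(sF) is the exponential generating function in s of the powers of F,
  differentiating at s = 0 isolates one power. This ties the sums over compositions to analysis in
  s.\<close>

lemma higher_deriv_exp_compose_nth:
  fixes F :: "complex fps"
  assumes "fps_nth F 0 = 0"
  shows "(deriv ^^ k) (\<lambda>s. fps_nth (fps_exp s oo F) n) 0 = fps_nth (F ^ k) n"
proof -
  have "(\<lambda>s. fps_nth (fps_exp s oo F) n) has_fps_expansion Abs_fps (\<lambda>i. fps_nth (F ^ i) n / fact i)"
    by (rule has_fps_expansionI) (use exp_compose_nth_sums[OF assms] in simp)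
  from fps_nth_fps_expansion[OF this, of k] show ?thesis by simp
qed

lemma holomorphic_exp_compose_nth [holomorphic_intros]:
  "(\<lambda>s. fps_nth (fps_exp s oo F) n) holomorphic_on A" for F :: "complex fps"
  unfolding fps_compose_nth by (auto intro!: holomorphic_intros)

lemma higher_deriv_exp_mult: "(deriv ^^ k) (\<lambda>s. exp (s * c)) 0 = c ^ k" for c :: complex
  using fps_nth_fps_expansion[OF has_fps_expansion_exp[of c], of k] by (simp add: mult.commute)

text \<open>Cauchy's inequality for exp(s h) on the circle |x| = 2 gives the geometric decay; the
  point 1 lies inside the disc, so the coefficients sum to the value there.\<close>

lemma exp_compose_nth_bound:
  fixes h :: "complex \<Rightarrow> complex"
  assumes h: "h holomorphic_on ball 0 R" "R > 2" "h has_fps_expansion G" "fps_nth G 0 = 0"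
  obtains M where "M > 0"
    and "\<And>s j. norm s \<le> 1 / 2 \<Longrightarrow> norm (fps_nth (fps_exp s oo G) j) \<le> M / 2 ^ j"
    and "\<And>s. (\<lambda>j. fps_nth (fps_exp s oo G) j) sums exp (s * h 1)"
proof -
  have "continuous_on (cball 0 2) h"
    using h(1,2) by (intro holomorphic_on_imp_continuous_on holomorphic_on_subset[OF h(1)]) auto
  hence "compact (h ` cball 0 2)"
    by (intro compact_continuous_image) auto
  then obtain B where B: "norm (h x) \<le> B" if "norm x \<le> 2" for x
    by (force dest!: compact_imp_bounded simp: bounded_iff)
  have expansion: "(\<lambda>x. exp (s * h x)) has_fps_expansion (fps_exp s oo G)" for s
    using has_fps_expansion_compose[OF has_fps_expansion_exp h(3,4)] by (simp add: o_def)
  show ?thesis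
  proof
    \<comment> \<open>This is the choice of M: B bounds h on the closed disc of radius 2, and |s| <=
      1/2 gives |exp(s h)| <= exp(B/2).\<close>
    show "exp (B / 2) > 0" by simp
  next
    fix s :: complex and j :: nat
    assume s: "norm s \<le> 1 / 2"
    have "norm ((deriv ^^ j) (\<lambda>x. exp (s * h x)) 0) \<le> fact j * exp (B / 2) / 2 ^ j"
    proof (rule Cauchy_inequality)
      show hol: "(\<lambda>x. exp (s * h x)) holomorphic_on ball 0 2"
        by (intro holomorphic_intros holomorphic_on_subset[OF h(1)]) (use h(2) in auto)
      have "(\<lambda>x. exp (s * h x)) holomorphic_on cball 0 2"
        by (intro holomorphic_intros holomorphic_on_subset[OF h(1)]) (use h(2) in auto)
      thus "continuous_on (cball 0 2) (\<lambda>x. exp (s * h x))"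
        by (rule holomorphic_on_imp_continuous_on)
    next
      fix x :: complex assume "norm (0 - x) = 2"
      hence "norm (s * h x) \<le> 1 / 2 * B"
        unfolding norm_mult using s B[of x] by (intro mult_mono) auto
      thus "norm (exp (s * h x)) \<le> exp (B / 2)"
        using complex_Re_le_cmod[of "s * h x"] by (simp del: times_complex.simps)
    qed auto
    thus "norm (fps_nth (fps_exp s oo G) j) \<le> exp (B / 2) / 2 ^ j"
      by (simp add: fps_nth_fps_expansion[OF expansion] norm_divide divide_simps mult.commute)
  next
    fix s :: complex
    have "(\<lambda>j. (deriv ^^ j) (\<lambda>x. exp (s * h x)) 0 / fact j * (1 - 0) ^ j) sums exp (s * h 1)"
      by (rule holomorphic_power_series[where r = R])
         (use h(1,2) in \<open>auto intro!: holomorphic_intros\<close>)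
    thus "(\<lambda>j. fps_nth (fps_exp s oo G) j) sums exp (s * h 1)"
      by (simp add: fps_nth_fps_expansion[OF expansion])
  qed
qed

text \<open>For 2j <= n the asymptotics at m = n - j are transported to n. For larger j the trivial
  bound 9n suffices, because n < 2j. Polynomial growth in j is affordable, since the bound will be
  summed against 2^(-j).\<close>

lemma shifted_pochhammer_asymptotics:
  fixes s :: complex
  assumes s: "norm s \<le> 1 / 2" and n: "n > 0" and j: "j \<le> n"
  shows "norm (of_nat n * (pochhammer s (n - j) / fact (n - j)) - rGamma s * exp (s * of_real (ln (real n))))
           \<le> 128 * (real j + 1)\<^sup>2 / sqrt (real n)"
proof (cases "2 * j \<le> n")
  case True
  define m where "m = n - j"
  define T where "T = (\<lambda>k. rGamma s * exp (s * of_real (ln (real k))))"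
  have m: "m > 0" "real n \<le> 2 * real m" "real n = real m + real j"
    using True n by (auto simp: m_def)
  let ?a = "pochhammer s m / fact m"
  have e1: "norm (of_nat n / of_nat m * (of_nat m * ?a - T m)) \<le> 2 * (16 / sqrt (real m))"
    unfolding norm_mult T_def using m s
    by (intro mult_mono pochhammer_asymptotics) (auto simp: norm_divide divide_simps)
  have T_m: "norm (T m) \<le> 8 * sqrt (real m)"
    unfolding T_def norm_mult
    using m s by (intro mult_mono norm_rGamma_le norm_exp_mult_ln_le) auto
  have nm: "of_nat n / of_nat m - 1 = (of_real (real j / real m) :: complex)"
  proof -
    have "complex_of_nat n = of_nat m + of_nat j"
      using m(3) by (metis of_nat_add of_nat_eq_iff)
    thus ?thesis using m(1) by (simp add: field_simps)
  qed
  have sqrt_m: "8 * sqrt (real m) * (real j / real m) = 8 * real j / sqrt (real m)"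
    using m(1) by (simp add: field_simps)
  have "norm ((of_nat n / of_nat m - 1) * T m) \<le> real j / real m * (8 * sqrt (real m))"
    unfolding norm_mult nm norm_of_real using T_m by (intro mult_mono) auto
  hence e2: "norm ((of_nat n / of_nat m - 1) * T m) \<le> 8 * real j / sqrt (real m)"
    by (simp only: sqrt_m[symmetric]) (simp only: mult_ac)
  define d where "d = s * of_real (ln (real n) - ln (real m))"
  have "ln (real n) - ln (real m) = ln (1 + real j / real m)"
  proof -
    have "1 + real j / real m = real n / real m"
      using m by (simp add: field_simps)
    thus ?thesis using m n by (simp add: ln_div)
  qed
  also have "\<dots> \<le> real j / real m"
    by (rule ln_add_one_self_le_self) simp
  finally have ln1: "ln (real n) - ln (real m) \<le> real j / real m" .
  have ln0: "ln (real n) - ln (real m) \<ge> 0" using m n by simp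
  have d: "norm d \<le> 1 / 2 * (real j / real m)"
    unfolding d_def norm_mult norm_of_real using s ln0 ln1 by (intro mult_mono) auto
  \<comment> \<open>With the bound on \<open>d\<close> this yields |d| <= 1/2, the range in which
    exp d - 1 is controlled.\<close>
  have "real j / real m \<le> 1" using m True by (simp add: field_simps)
  hence "norm (exp d - 1) \<le> 2 * norm d"
    using d by (intro norm_exp_minus_one_le) simp
  hence "norm (exp d - 1) \<le> real j / real m" using d by simp
  moreover have "T n - T m = T m * (exp d - 1)"
    by (simp add: T_def d_def algebra_simps exp_diff)
  ultimately have "norm (T n - T m) \<le> 8 * sqrt (real m) * (real j / real m)"
    unfolding \<open>T n - T m = _\<close> norm_mult using T_m by (intro mult_mono) auto
  hence e3: "norm (T n - T m) \<le> 8 * real j / sqrt (real m)"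
    by (simp only: sqrt_m)
  \<comment> \<open>Three errors: the asymptotics at m, the replacement of n/m by 1, and the
    replacement of m^s by n^s.\<close>
  have "of_nat n * ?a - T n =
          of_nat n / of_nat m * (of_nat m * ?a - T m) + (of_nat n / of_nat m - 1) * T m - (T n - T m)"
    using m(1) by (simp add: field_simps)
  moreover have "norm (x + y - z) \<le> norm x + norm y + norm z" for x y z :: complex
    using norm_triangle_ineq4[of "x + y" z] norm_triangle_ineq[of x y] by linarith
  ultimately have "norm (of_nat n * ?a - T n) \<le>
           norm (of_nat n / of_nat m * (of_nat m * ?a - T m)) + norm ((of_nat n / of_nat m - 1) * T m)
             + norm (T n - T m)"
    by presburger
  also have "\<dots> \<le> 2 * (16 / sqrt (real m)) + 8 * real j / sqrt (real m) + 8 * real j / sqrt (real m)"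
    by (intro add_mono e1 e2 e3)
  also have "\<dots> = 16 * (2 + real j) / sqrt (real m)"
    by (simp add: add_divide_distrib distrib_left)
  also have "\<dots> \<le> 16 * (2 + real j) / (sqrt (real n) / 2)"
  proof (intro divide_left_mono)
    have "sqrt (real n) \<le> sqrt (4 * real m)" using m by (intro real_sqrt_le_mono) auto
    thus "sqrt (real n) / 2 \<le> sqrt (real m)" by (simp add: real_sqrt_mult)
  qed (use m n in auto)
  also have "\<dots> = 32 * (2 + real j) / sqrt (real n)"
    by simp
  also have "\<dots> \<le> 128 * (real j + 1)\<^sup>2 / sqrt (real n)"
    using n by (intro divide_right_mono) (auto simp: power2_eq_square algebra_simps)
  finally show ?thesis by (simp add: T_def m_def)
next
  case False
  hence j2: "real n \<le> 2 * real j" by simp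
  have n1: "real n \<ge> 1" using n by simp
  have sq: "sqrt (real n) \<le> real n" "sqrt (real n) \<ge> 1"
    using n1 real_le_lsqrt[of "real n" "real n"] mult_left_mono[of 1 "real n" "real n"]
    by (auto simp: power2_eq_square)
  have "norm (of_nat n * (pochhammer s (n - j) / fact (n - j)) - rGamma s * exp (s * of_real (ln (real n))))
          \<le> norm (of_nat n * (pochhammer s (n - j) / fact (n - j)))
             + norm (rGamma s * exp (s * of_real (ln (real n))))"
    by (rule norm_triangle_ineq4)
  also have "\<dots> \<le> real n * 1 + 8 * sqrt (real n)"
    unfolding norm_mult[of "of_nat n"] norm_mult[of "rGamma s"] using s n1
    by (intro add_mono mult_mono norm_pochhammer_le norm_rGamma_le norm_exp_mult_ln_le) auto
  also have "\<dots> \<le> 9 * real n" using sq by simp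
  also have "\<dots> = 9 * (real n * sqrt (real n)) / sqrt (real n)"
    using n by simp
  also have "\<dots> \<le> 128 * (real j + 1)\<^sup>2 / sqrt (real n)"
  proof (intro divide_right_mono)
    have "real n * sqrt (real n) \<le> real n * real n" using sq by (intro mult_left_mono) auto
    also have "\<dots> \<le> (2 * (real j + 1)) * (2 * (real j + 1))" using j2 by (intro mult_mono) auto
    also have "\<dots> = 4 * (real j + 1)\<^sup>2" by (simp add: power2_eq_square algebra_simps)
    finally show "9 * (real n * sqrt (real n)) \<le> 128 * (real j + 1)\<^sup>2"
      using zero_le_power2[of "real j + 1"] by linarith
  qed auto
  finally show ?thesis .
qed

subsection \<open>Coefficients of powers of power series\<close>

lemma summable_square_over_power2: "summable (\<lambda>j. (real j + 1)\<^sup>2 / 2 ^ j)"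
proof (rule summable_ratio_test[where c = "3 / 4" and N = 4])
  fix j :: nat assume "4 \<le> j"
  \<comment> \<open>The ratio of consecutive terms is at most 3/4 exactly when 2j + 5 <= j^2, which
    holds from j = 4 on.\<close>
  hence "2 * real j + 5 \<le> (real j)\<^sup>2"
    using mult_right_mono[of 4 "real j" "real j"] unfolding power2_eq_square by linarith
  hence "2 * (real j + 2)\<^sup>2 \<le> 3 * (real j + 1)\<^sup>2"
    by (simp add: power2_eq_square algebra_simps)
  hence "2 * (real j + 2)\<^sup>2 / (4 * 2 ^ j) \<le> 3 * (real j + 1)\<^sup>2 / (4 * 2 ^ j)"
    by (rule divide_right_mono) simp
  thus "norm ((real (Suc j) + 1)\<^sup>2 / 2 ^ Suc j) \<le> 3 / 4 * norm ((real j + 1)\<^sup>2 / 2 ^ j)"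
    by (simp add: add.commute)
qed simp

text \<open>The coefficient is a convolution of those of exp(sG) with those of (1 - x)^(-s).
  Replacing each n a_(n-j) by the main term \<open>T\<close> leaves \<open>T\<close> times the sum
  of the coefficients of exp(sG), which is exp(s h(1)). The errors are weighted by (j + 1)^2 / 2^j
  and add up to O(1/sqrt n).\<close>

lemma exp_compose_nth_asymptotics:
  fixes h :: "complex \<Rightarrow> complex"
  assumes h: "h holomorphic_on ball 0 R" "R > 2" "h has_fps_expansion G" "fps_nth G 0 = 0"
  obtains C where "C > 0"
    and "\<And>s n. norm s \<le> 1 / 2 \<Longrightarrow> n > 0 \<Longrightarrow>
           norm (of_nat n * fps_nth (fps_exp s oo (log_fps + G)) n
                   - rGamma s * exp (s * (of_real (ln (real n)) + h 1))) \<le> C / sqrt (real n)"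
proof -
  obtain M where M: "M > 0"
    and M_bound: "\<And>s j. norm s \<le> 1 / 2 \<Longrightarrow> norm (fps_nth (fps_exp s oo G) j) \<le> M / 2 ^ j"
    and sums_h: "\<And>s. (\<lambda>j. fps_nth (fps_exp s oo G) j) sums exp (s * h 1)"
    using exp_compose_nth_bound[OF h] by blast
  define S where "S = (\<Sum>j. (real j + 1)\<^sup>2 / 2 ^ j)"
  have S: "(\<lambda>j. (real j + 1)\<^sup>2 / 2 ^ j) sums S"
    unfolding S_def using summable_square_over_power2 by (rule summable_sums)
  have "S > 0"
    unfolding S_def by (rule suminf_pos[OF summable_square_over_power2]) simp
  show ?thesis
  proof
    show "128 * M * S > 0" using M \<open>S > 0\<close> by simp
  next
    fix s :: complex and n :: nat
    assume s: "norm s \<le> 1 / 2" and n: "n > 0"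
    define e where "e = fps_nth (fps_exp s oo G)"
    define T where "T = rGamma s * exp (s * of_real (ln (real n)))"
    \<comment> \<open>Extension by 0 beyond n turns the finite convolution into a series over all j,
      to be compared termwise with the series for exp(s h(1)).\<close>
    define w where "w = (\<lambda>j. if j \<le> n then of_nat n * (pochhammer s (n - j) / fact (n - j)) else 0)"
    have "fps_exp s oo (log_fps + G) = (fps_exp s oo G) * (fps_exp s oo log_fps)"
      using exp_compose_add[OF has_fps_expansion_log h(3) _ h(4)] by (simp add: mult.commute)
    hence coeff: "of_nat n * fps_nth (fps_exp s oo (log_fps + G)) n = (\<Sum>j\<in>{0..n}. e j * w j)"
      by (simp add: fps_mult_nth exp_compose_log_fps e_def w_def sum_distrib_left mult_ac)
    have "(\<lambda>j. e j * w j) sums (\<Sum>j\<in>{0..n}. e j * w j)"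
      by (intro sums_finite) (auto simp: w_def)
    moreover have "(\<lambda>j. e j * T) sums (exp (s * h 1) * T)"
      unfolding e_def by (intro sums_mult2 sums_h)
    ultimately have "(\<lambda>j. e j * w j - e j * T) sums
        (of_nat n * fps_nth (fps_exp s oo (log_fps + G)) n - exp (s * h 1) * T)"
      unfolding coeff by (rule sums_diff)
    moreover have "(\<lambda>j. (M * 128 / sqrt (real n)) * ((real j + 1)\<^sup>2 / 2 ^ j)) sums (M * 128 / sqrt (real n) * S)"
      by (intro sums_mult S)
    moreover have "norm (e j * w j - e j * T) \<le> (M * 128 / sqrt (real n)) * ((real j + 1)\<^sup>2 / 2 ^ j)" for j
    proof -
      have "norm (w j - T) \<le> 128 * (real j + 1)\<^sup>2 / sqrt (real n)"
      proof (cases "j \<le> n")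
        case True
        thus ?thesis
          unfolding w_def T_def using shifted_pochhammer_asymptotics[OF s n True] by simp
      next
        \<comment> \<open>In the tail the error is \<open>T\<close> itself, of size O(sqrt n) = O(n
          / sqrt n), and n < j absorbs it.\<close>
        case False
        have "norm (w j - T) = norm T" using False by (simp add: w_def)
        also have "\<dots> \<le> 8 * sqrt (real n)"
          unfolding T_def norm_mult using s n
          by (intro mult_mono norm_rGamma_le norm_exp_mult_ln_le) auto
        also have "\<dots> = 8 * real n / sqrt (real n)"
          using n by (simp add: field_simps)
        also have "\<dots> \<le> 128 * (real j + 1)\<^sup>2 / sqrt (real n)"
        proof (intro divide_right_mono)
          have "real n \<le> real j + 1" using False by simp
          also have "\<dots> * 1 \<le> (real j + 1) * (real j + 1)" by (intro mult_left_mono) auto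
          finally show "8 * real n \<le> 128 * (real j + 1)\<^sup>2" by (simp add: power2_eq_square)
        qed auto
        finally show ?thesis .
      qed
      moreover have "norm (e j) \<le> M / 2 ^ j"
        unfolding e_def using s by (rule M_bound)
      ultimately have "norm (e j * (w j - T)) \<le> M / 2 ^ j * (128 * (real j + 1)\<^sup>2 / sqrt (real n))"
        unfolding norm_mult using M by (intro mult_mono) auto
      thus ?thesis by (simp add: algebra_simps)
    qed
    ultimately have "norm (of_nat n * fps_nth (fps_exp s oo (log_fps + G)) n - exp (s * h 1) * T)
                       \<le> M * 128 / sqrt (real n) * S"
      by (rule norm_sums_le)
    thus "norm (of_nat n * fps_nth (fps_exp s oo (log_fps + G)) n
                   - rGamma s * exp (s * (of_real (ln (real n)) + h 1))) \<le> 128 * M * S / sqrt (real n)"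
      by (simp add: T_def distrib_left exp_add mult_ac)
  qed
qed

text \<open>Cauchy's inequality in s on |s| = 1/2 costs the factor 2^k k!. The k-th derivative at 0
  turns exp(sF) into F^k, and by Leibniz's rule it turns the main term into the binomial
  sum.\<close>

lemma power_nth_asymptotics:
  fixes h :: "complex \<Rightarrow> complex"
  assumes h: "h holomorphic_on ball 0 R" "R > 2" "h has_fps_expansion G" "fps_nth G 0 = 0"
  obtains C where "C > 0"
    and "\<And>k n. n > 0 \<Longrightarrow>
           norm (of_nat n * fps_nth ((log_fps + G) ^ k) n
                  - (\<Sum>j=0..k. of_nat (k choose j) * (deriv ^^ j) rGamma 0 *
                                (of_real (ln (real n)) + h 1) ^ (k - j)))
             \<le> C * 2 ^ k * fact k / sqrt (real n)"
proof -
  obtain C where C: "C > 0"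
    and bound: "\<And>s n. norm s \<le> 1 / 2 \<Longrightarrow> n > 0 \<Longrightarrow>
           norm (of_nat n * fps_nth (fps_exp s oo (log_fps + G)) n
                   - rGamma s * exp (s * (of_real (ln (real n)) + h 1))) \<le> C / sqrt (real n)"
    using exp_compose_nth_asymptotics[OF h] by blast
  show ?thesis
  proof
    fix k n :: nat
    assume n: "n > 0"
    define c where "c = of_real (ln (real n)) + h 1"
    define P where "P = (\<lambda>s. fps_nth (fps_exp s oo (log_fps + G)) n)"
    have P: "P holomorphic_on A" for A
      unfolding P_def by (rule holomorphic_exp_compose_nth)
    have nP: "(\<lambda>s. of_nat n * P s) holomorphic_on A" for A
      by (intro holomorphic_intros P)
    have E: "(\<lambda>s. rGamma s * exp (s * c)) holomorphic_on A" for A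
      by (intro holomorphic_intros)
    have "norm ((deriv ^^ k) (\<lambda>s. of_nat n * P s - rGamma s * exp (s * c)) 0)
            \<le> fact k * (C / sqrt (real n)) / (1 / 2) ^ k"
    proof (rule Cauchy_inequality)
      have "(\<lambda>s. of_nat n * P s - rGamma s * exp (s * c)) holomorphic_on A" for A
        by (intro holomorphic_on_diff nP E)
      thus "(\<lambda>s. of_nat n * P s - rGamma s * exp (s * c)) holomorphic_on ball 0 (1 / 2)"
        and "continuous_on (cball 0 (1 / 2)) (\<lambda>s. of_nat n * P s - rGamma s * exp (s * c))"
        by (blast intro: holomorphic_on_imp_continuous_on)+
    qed (use bound n in \<open>auto simp: P_def c_def\<close>)
    also have "(deriv ^^ k) (\<lambda>s. of_nat n * P s - rGamma s * exp (s * c)) 0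
                 = (deriv ^^ k) (\<lambda>s. of_nat n * P s) 0 - (deriv ^^ k) (\<lambda>s. rGamma s * exp (s * c)) 0"
      by (rule higher_deriv_diff[OF nP E open_UNIV]) simp
    also have "(deriv ^^ k) (\<lambda>s. of_nat n * P s) 0 = of_nat n * (deriv ^^ k) P 0"
      by (rule higher_deriv_cmult[OF P _ open_UNIV]) simp
    also have "(deriv ^^ k) P 0 = fps_nth ((log_fps + G) ^ k) n"
      unfolding P_def by (rule higher_deriv_exp_compose_nth) (simp add: h(4))
    also have "(deriv ^^ k) (\<lambda>s. rGamma s * exp (s * c)) 0 =
                 (\<Sum>j=0..k. of_nat (k choose j) * (deriv ^^ j) rGamma 0 * c ^ (k - j))"
      by (subst higher_deriv_mult[where S = UNIV])
         (auto intro!: holomorphic_intros simp: higher_deriv_exp_mult)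
    finally show "norm (of_nat n * fps_nth ((log_fps + G) ^ k) n
                  - (\<Sum>j=0..k. of_nat (k choose j) * (deriv ^^ j) rGamma 0 *
                                (of_real (ln (real n)) + h 1) ^ (k - j)))
             \<le> C * 2 ^ k * fact k / sqrt (real n)"
      by (simp add: c_def power_divide mult_ac)
  qed (rule C)
qed

subsection \<open>Derivatives of the reciprocal Gamma function\<close>

text \<open>\<open>phi\<close> uses real derivatives, while Cauchy's inequality concerns complex
  ones. The induction works because the derivative of an entire function that is real on the real
  line is again of this kind.\<close>

lemma higher_deriv_of_real:
  fixes f :: "complex \<Rightarrow> complex" and g :: "real \<Rightarrow> real"
  assumes "f holomorphic_on UNIV" "\<And>x. f (of_real x) = of_real (g x)"
  shows "(deriv ^^ n) f (of_real x) = of_real ((deriv ^^ n) g x)"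
  using assms
proof (induction n arbitrary: f g)
  case (Suc n)
  have "deriv f (of_real x) = of_real (deriv g x)" for x
  proof -
    have f: "f field_differentiable at (of_real x)"
      using Suc.prems(1) by (simp add: holomorphic_on_imp_differentiable_at)
    hence "((\<lambda>x. f (of_real x)) has_vector_derivative deriv f (of_real x)) (at x)"
      by (intro has_vector_derivative_real_field) (simp add: DERIV_deriv_iff_field_differentiable)
    \<comment> \<open>Taking real parts shows that \<open>g\<close> is differentiable, so that
      \<open>deriv g x\<close> is a genuine derivative.\<close>
    hence "((\<lambda>x. Re (f (of_real x))) has_vector_derivative Re (deriv f (of_real x))) (at x)"
      by (rule bounded_linear.has_vector_derivative[OF bounded_linear_Re])
    hence "g differentiable at x"
      by (simp add: Suc.prems(2) differentiableI_vector)
    thus ?thesis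
      using vector_derivative_of_real_left[of g x, where ?'a = complex] vector_derivative_of_real_right[OF f]
      by (simp add: Suc.prems(2))
  qed
  moreover have "deriv f holomorphic_on UNIV"
    using Suc.prems(1) by (simp add: holomorphic_deriv)
  ultimately have "(deriv ^^ n) (deriv f) (of_real x) = of_real ((deriv ^^ n) (deriv g) x)"
    by (intro Suc.IH)
  thus ?case by (simp only: funpow_Suc_right o_apply)
qed simp

text \<open>Euler's reflection formula. For s < 1 the point 1 - s is not a pole of Gamma, so
  division by \<open>rGamma (1 - s)\<close> is legitimate.\<close>

lemma Gamma_sin_eq_rGamma:
  fixes s :: real
  assumes "s < 1"
  shows "Gamma (1 - s) * sin (pi * s) = pi * rGamma s"
proof -
  have "complex_of_real (rGamma s * rGamma (1 - s)) = of_real (sin (pi * s) / pi)"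
    using rGamma_reflection_complex[of "of_real s"]
    by (simp flip: rGamma_complex_of_real sin_of_real)
  hence "rGamma s * rGamma (1 - s) = sin (pi * s) / pi"
    by (simp only: of_real_eq_iff)
  moreover have "rGamma (1 - s) \<noteq> 0"
    using assms by (auto simp: rGamma_eq_zero_iff elim!: nonpos_Ints_cases)
  ultimately show ?thesis
    by (simp add: Gamma_def field_simps)
qed

text \<open>The reflection formula holds in a neighbourhood of 0, which determines all derivatives
  there; since \<open>rGamma\<close> is entire, they agree with the complex ones.\<close>

lemma phi_eq_higher_deriv_rGamma: "complex_of_real (phi j) = (deriv ^^ j) rGamma 0"
proof -
  have "eventually (\<lambda>s. s \<in> {..<1}) (nhds (0::real))"
    by (intro eventually_nhds_in_open) auto
  hence "eventually (\<lambda>s. Gamma (1 - s) * sin (pi * s) = pi * rGamma s) (nhds (0::real))"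
    by eventually_elim (simp add: Gamma_sin_eq_rGamma)
  hence "(deriv ^^ j) (\<lambda>s::real. Gamma (1 - s) * sin (pi * s)) 0 = (deriv ^^ j) (\<lambda>s. pi * rGamma s) 0"
    by (rule higher_deriv_cong_ev) simp
  also have "complex_of_real \<dots> = (deriv ^^ j) (\<lambda>s. of_real pi * rGamma s) 0"
    by (subst higher_deriv_of_real[where x = 0, simplified, symmetric])
       (auto intro!: holomorphic_intros simp: rGamma_complex_of_real)
  also have "\<dots> = of_real pi * (deriv ^^ j) rGamma 0"
    by (rule higher_deriv_cmult[OF holomorphic_rGamma _ open_UNIV]) simp
  finally show ?thesis by (simp add: phi_def)
qed

subsection \<open>Sums over compositions and the zeta series\<close>

text \<open>The library expansion runs over \<open>natpermute\<close>, which also admits zero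
  entries; such tuples contribute 0 because F has no constant term.\<close>

lemma fps_power_nth_compositions:
  fixes F :: "'a :: comm_ring_1 fps"
  assumes "fps_nth F 0 = 0" "k > 0"
  shows "fps_nth (F ^ k) m = (\<Sum>a\<in>compositions k m. \<Prod>i<k. fps_nth F (a ! i))"
proof -
  \<comment> \<open>Subtraction is truncated, so this relies on k being positive.\<close>
  have "{0..k - 1} = {..<k}" using assms(2) by auto
  hence "fps_nth (F ^ k) m = (\<Sum>a\<in>natpermute m k. \<Prod>i<k. fps_nth F (a ! i))"
    using assms(2) by (simp add: fps_power_nth)
  also have "\<dots> = (\<Sum>a\<in>compositions k m. \<Prod>i<k. fps_nth F (a ! i))"
  proof (rule sum.mono_neutral_right)
    show "compositions k m \<subseteq> natpermute m k"
      by (auto simp: compositions_def natpermute_def sum_list_sum_nth atLeast0LessThan)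
    show "\<forall>a\<in>natpermute m k - compositions k m. (\<Prod>i<k. fps_nth F (a ! i)) = 0"
    proof
      fix a assume "a \<in> natpermute m k - compositions k m"
      then obtain i where "i < k" "a ! i = 0"
        by (auto simp: compositions_def natpermute_def sum_list_sum_nth atLeast0LessThan)
      thus "(\<Prod>i<k. fps_nth F (a ! i)) = 0"
        using assms(1) by (intro prod_zero bexI[of _ i]) auto
    qed
  qed (rule natpermute_finite)
  finally show ?thesis .
qed

section \<open>The series with coefficients (zeta(2a) - 1)/a\<close>

lemma zeta_minus_one_sums:
  assumes "a > 0"
  shows "(\<lambda>n. (1 / (real n + 2)\<^sup>2) ^ a) sums (zeta (2 * real a) - 1)"
proof -
  have eq: "1 / real (Suc n) powr (2 * real a) = (1 / (real n + 1)\<^sup>2) ^ a" for n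
    using powr_realpow[of "real (Suc n)" "2 * a"]
    by (simp add: power_mult power_one_over add.commute flip: of_nat_Suc)
  have "summable (\<lambda>n. inverse (real n ^ (2 * a)))"
    using assms by (intro inverse_power_summable) auto
  hence "summable (\<lambda>n. inverse (real (Suc n) ^ (2 * a)))"
    by (subst summable_Suc_iff)
  hence "summable (\<lambda>n. (1 / (real n + 1)\<^sup>2) ^ a)"
    by (simp add: power_mult power_one_over inverse_eq_divide add.commute)
  hence "(\<lambda>n. (1 / (real n + 1)\<^sup>2) ^ a) sums zeta (2 * real a)"
    unfolding zeta_def eq by (rule summable_sums)
  \<comment> \<open>The shift drops the first term 1^a = 1, which is the 1 that is
    subtracted.\<close>
  hence "(\<lambda>n. (1 / (real (Suc n) + 1)\<^sup>2) ^ a) sums (zeta (2 * real a) - 1)"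
    by (subst sums_Suc_iff) simp
  thus ?thesis by (simp add: add.commute)
qed

text \<open>For n >= 2, 1 - 1/n^2 is the quotient of (n+1)/n by n/(n-1), so the series telescopes
  from log 2 down to log 1.\<close>

lemma sums_ln_two: "(\<lambda>n. - ln (1 - 1 / (real n + 2)\<^sup>2)) sums ln 2"
proof -
  define f where "f = (\<lambda>n. ln (1 + 1 / real (Suc n)))"
  have "(\<lambda>n. 1 + 1 / real (Suc n)) \<longlonglongrightarrow> 1 + 0"
    by (intro tendsto_intros LIMSEQ_Suc lim_1_over_n)
  hence "f \<longlonglongrightarrow> ln 1"
    unfolding f_def by (intro tendsto_ln) auto
  hence "(\<lambda>n. f n - f (Suc n)) sums (f 0 - ln 1)"
    by (rule telescope_sums')
  moreover have "f n - f (Suc n) = - ln (1 - 1 / (real n + 2)\<^sup>2)" for n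
  proof -
    have pos: "1 + 1 / real (Suc n) > 0" "1 + 1 / real (Suc (Suc n)) > 0"
      by (auto intro: add_pos_nonneg)
    have "- (f n - f (Suc n)) = ln ((1 + 1 / real (Suc (Suc n))) / (1 + 1 / real (Suc n)))"
      using pos by (simp add: f_def ln_div)
    also have "(1 + 1 / real (Suc (Suc n))) / (1 + 1 / real (Suc n)) = 1 - 1 / (real n + 2)\<^sup>2"
      by (simp add: divide_simps add_eq_0_iff) (simp add: power2_eq_square algebra_simps)
    finally show ?thesis by simp
  qed
  ultimately show ?thesis by (simp add: f_def)
qed

text \<open>The double series of n^(-2a)/a over n >= 2 is summed in both orders, which nonnegativity
  permits. Summing over a first gives -log(1 - n^(-2)); summing over n first gives (zeta(2a) -
  1)/a.\<close>

lemma zeta_minus_one_over_sums: "(\<lambda>a. (zeta (2 * real a) - 1) / real a) sums ln 2"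
proof -
  \<comment> \<open>Division by zero makes the terms with a = 0 vanish, so a may run over all
    natural numbers.\<close>
  define f where "f = (\<lambda>(n, a). (1 / (real n + 2)\<^sup>2) ^ a / real a)"
  have nonneg: "f p \<ge> 0" for p
    by (auto simp: f_def split: prod.split)
  have less: "1 / (real n + 2)\<^sup>2 < 1" for n
    by (simp add: power2_eq_square algebra_simps add_pos_nonneg)
  have inner: "((\<lambda>a. f (n, a)) has_sum - ln (1 - 1 / (real n + 2)\<^sup>2)) UNIV" for n
  proof (rule sums_nonneg_imp_has_sum)
    have "(\<lambda>a. - ((1 / (real n + 2)\<^sup>2) ^ a) / real a) sums ln (1 - 1 / (real n + 2)\<^sup>2)"
      using ln_series'[of "- (1 / (real n + 2)\<^sup>2)"] less[of n] by simp
    from sums_minus[OF this] show "(\<lambda>a. f (n, a)) sums - ln (1 - 1 / (real n + 2)\<^sup>2)"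
      by (simp add: f_def)
  qed (rule nonneg)
  have "- ln (1 - 1 / (real n + 2)\<^sup>2) \<ge> 0" for n
    using inner[of n] by (rule has_sum_nonneg) (simp add: nonneg)
  hence outer: "((\<lambda>n. - ln (1 - 1 / (real n + 2)\<^sup>2)) has_sum ln 2) UNIV"
    by (rule sums_nonneg_imp_has_sum[OF sums_ln_two])
  have "f summable_on (UNIV \<times> UNIV)"
    by (rule summable_on_SigmaI[OF inner]) (use outer nonneg in \<open>auto simp: summable_on_def\<close>)
  hence "(f has_sum ln 2) (UNIV \<times> UNIV)"
    by (rule has_sum_SigmaI[OF inner outer])
  hence "((\<lambda>(a, n). f (n, a)) has_sum ln 2) (UNIV \<times> UNIV)"
    by (subst (asm) has_sum_swap)
  hence "((\<lambda>a. (zeta (2 * real a) - 1) / real a) has_sum ln 2) UNIV"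
  proof (rule has_sum_SigmaD)
    fix a :: nat
    have "(\<lambda>n. f (n, a)) sums ((zeta (2 * real a) - 1) / real a)"
      unfolding f_def prod.case
      by (cases "a = 0") (auto intro: sums_divide zeta_minus_one_sums)
    hence "((\<lambda>n. f (n, a)) has_sum ((zeta (2 * real a) - 1) / real a)) UNIV"
      by (rule sums_nonneg_imp_has_sum) (rule nonneg)
    thus "((\<lambda>n. (case (a, n) of (a, n) \<Rightarrow> f (n, a))) has_sum ((zeta (2 * real a) - 1) / real a)) UNIV"
      by simp
  qed
  thus ?thesis by (rule has_sum_imp_sums)
qed

text \<open>Subtracting 1 from zeta(2a) splits off \<open>log_fps\<close>, which carries the
  singularity at 1. The constant coefficient is 0 by division by zero.\<close>

definition zeta_fps :: "complex fps" where
  "zeta_fps = Abs_fps (\<lambda>a. of_real ((zeta (2 * real a) - 1) / real a))"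

text \<open>As n^(-2) <= 1/4 for n >= 2, zeta(2a) - 1 is O(4^(-a)). The value 3 leaves room above
  the radius 2 used in Cauchy's inequality.\<close>

lemma fps_conv_radius_zeta_fps: "fps_conv_radius zeta_fps \<ge> 3"
proof -
  define K where "K = zeta 2 - 1"
  have bound: "\<bar>(zeta (2 * real a) - 1) / real a\<bar> \<le> 4 * K * (1 / 4) ^ a" if a: "a > 0" for a
  proof -
    \<comment> \<open>One factor n^(-2) is kept in each term so that the majorant converges; the
      other a - 1 factors are bounded by 1/4.\<close>
    have K: "(\<lambda>n. (1 / (real n + 2)\<^sup>2) * (1 / 4) ^ (a - 1)) sums (K * (1 / 4) ^ (a - 1))"
      unfolding K_def using zeta_minus_one_sums[of 1] by (intro sums_mult2) simp
    have "zeta (2 * real a) - 1 \<le> K * (1 / 4) ^ (a - 1)"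
    proof (rule sums_le[OF _ zeta_minus_one_sums[OF a] K])
      fix n :: nat
      have "(2::real)\<^sup>2 \<le> (real n + 2)\<^sup>2" by (intro power_mono) auto
      hence "1 / (real n + 2)\<^sup>2 \<le> 1 / 4" by (intro divide_left_mono) auto
      hence "(1 / (real n + 2)\<^sup>2) ^ (a - 1) \<le> (1 / 4) ^ (a - 1)" by (intro power_mono) auto
      hence "(1 / (real n + 2)\<^sup>2) * (1 / (real n + 2)\<^sup>2) ^ (a - 1) \<le> (1 / (real n + 2)\<^sup>2) * (1 / 4) ^ (a - 1)"
        by (intro mult_left_mono) auto
      thus "(1 / (real n + 2)\<^sup>2) ^ a \<le> (1 / (real n + 2)\<^sup>2) * (1 / 4) ^ (a - 1)"
        using a by (simp flip: power_Suc)
    qed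
    also have "\<dots> = 4 * K * (1 / 4) ^ a"
      using a by (cases a) auto
    finally have 1: "zeta (2 * real a) - 1 \<le> 4 * K * (1 / 4) ^ a" .
    have 0: "zeta (2 * real a) - 1 \<ge> 0"
      by (rule sums_le[OF _ sums_zero zeta_minus_one_sums[OF a]]) simp
    have "(zeta (2 * real a) - 1) / real a \<le> (zeta (2 * real a) - 1) / 1"
      using 0 a by (intro divide_left_mono) auto
    with 0 1 show ?thesis by simp
  qed
  have "summable (\<lambda>a. fps_nth zeta_fps a * 3 ^ a)"
  proof (rule summable_comparison_test)
    show "summable (\<lambda>a. 4 * K * (3 / 4 :: real) ^ a)"
      by (intro summable_mult summable_geometric) auto
    show "\<exists>N. \<forall>a\<ge>N. norm (fps_nth zeta_fps a * 3 ^ a) \<le> 4 * K * (3 / 4) ^ a"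
    proof (intro exI allI impI)
      fix a :: nat assume "a \<ge> 1"
      hence "\<bar>(zeta (2 * real a) - 1) / real a\<bar> * 3 ^ a \<le> 4 * K * (1 / 4) ^ a * 3 ^ a"
        by (intro mult_right_mono bound) auto
      thus "norm (fps_nth zeta_fps a * 3 ^ a) \<le> 4 * K * (3 / 4) ^ a"
        by (simp add: zeta_fps_def norm_mult norm_power power_divide del: of_real_divide of_real_diff)
    qed
  qed
  from conv_radius_geI[OF this] show ?thesis
    by (simp add: fps_conv_radius_def)
qed

lemma eval_fps_zeta_fps_1: "eval_fps zeta_fps 1 = of_real (ln 2)"
proof -
  have "(\<lambda>n. fps_nth zeta_fps n * 1 ^ n) sums eval_fps zeta_fps 1"
    by (rule sums_eval_fps) (use fps_conv_radius_zeta_fps in \<open>auto intro: less_le_trans[of _ 3]\<close>)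
  moreover have "(\<lambda>n. fps_nth zeta_fps n * 1 ^ n) sums of_real (ln 2)"
    using sums_of_real[OF zeta_minus_one_over_sums, where ?'a = complex]
    by (simp add: zeta_fps_def)
  ultimately show ?thesis by (rule sums_unique2)
qed

section \<open>Error bounds for H and Z\<close>

lemma sum_phi_eq:
  "complex_of_real (\<Sum>j=1..k. real (k choose j) * phi j * x ^ (k - j)) =
     (\<Sum>j=0..k. of_nat (k choose j) * (deriv ^^ j) rGamma 0 * of_real x ^ (k - j))"
  \<comment> \<open>The reciprocal Gamma function vanishes at 0, so the term j = 0 contributes
    nothing.\<close>
  by (simp add: sum.atLeast_Suc_atMost[of 0 k] phi_eq_higher_deriv_rGamma)

text \<open>The case G = 0 of \<open>power_nth_asymptotics\<close>, where log N is not
  shifted.\<close>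

lemma eps_H_bound:
  obtains C where "C > 0"
    "\<And>k N. k > 0 \<Longrightarrow> N > 0 \<Longrightarrow> eps_H k N \<le> C * 2 ^ k * fact k / sqrt (real N)"
proof -
  have h: "(\<lambda>_. 0) holomorphic_on ball 0 3" "(3::real) > 2"
          "(\<lambda>_. 0 :: complex) has_fps_expansion 0" "fps_nth (0 :: complex fps) 0 = 0"
    by simp_all
  obtain C where C: "C > 0"
    and bound: "\<And>k n. n > 0 \<Longrightarrow>
           norm (of_nat n * fps_nth ((log_fps + 0) ^ k) n
                  - (\<Sum>j=0..k. of_nat (k choose j) * (deriv ^^ j) rGamma 0 *
                                (of_real (ln (real n)) + 0) ^ (k - j)))
             \<le> C * 2 ^ k * fact k / sqrt (real n)"
    using power_nth_asymptotics[OF h] by blast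
  show ?thesis
  proof (rule that[OF C])
    fix k N :: nat assume "k > 0" "N > 0"
    have "fps_nth (log_fps ^ k) N = of_real (H k N)"
      using \<open>k > 0\<close> by (simp add: fps_power_nth_compositions H_def log_fps_def)
    hence "complex_of_real (real N * H k N - (\<Sum>j=1..k. real (k choose j) * phi j * ln (real N) ^ (k - j)))
             = of_nat N * fps_nth ((log_fps + 0) ^ k) N
                  - (\<Sum>j=0..k. of_nat (k choose j) * (deriv ^^ j) rGamma 0 *
                                (of_real (ln (real N)) + 0) ^ (k - j))"
      unfolding of_real_diff sum_phi_eq by simp
    from arg_cong[OF this, of norm] show "eps_H k N \<le> C * 2 ^ k * fact k / sqrt (real N)"
      unfolding norm_of_real eps_H_def using bound[OF \<open>N > 0\<close>, of k] by (simp only:)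
  qed
qed

text \<open>Here G is \<open>zeta_fps\<close>, and its value log 2 at 1 produces the shifted
  argument log N + log 2.\<close>

lemma eps_Z_bound:
  obtains C where "C > 0"
    "\<And>k N. k > 0 \<Longrightarrow> N > 0 \<Longrightarrow> eps_Z k N \<le> C * 2 ^ k * fact k / sqrt (real N)"
proof -
  have ball: "ball 0 3 \<subseteq> eball 0 (fps_conv_radius zeta_fps)"
    using fps_conv_radius_zeta_fps by (intro ball_eball_mono) simp
  have "fps_conv_radius zeta_fps > 0"
    using fps_conv_radius_zeta_fps by (rule less_le_trans[rotated]) simp
  moreover have z0: "fps_nth zeta_fps 0 = 0"
    by (simp add: zeta_fps_def)
  ultimately have h: "eval_fps zeta_fps holomorphic_on ball 0 3" "(3::real) > 2"
           "eval_fps zeta_fps has_fps_expansion zeta_fps" "fps_nth zeta_fps 0 = 0"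
    by (simp_all add: holomorphic_on_eval_fps[OF ball] eval_fps_has_fps_expansion)
  obtain C where C: "C > 0"
    and bound: "\<And>k n. n > 0 \<Longrightarrow>
           norm (of_nat n * fps_nth ((log_fps + zeta_fps) ^ k) n
                  - (\<Sum>j=0..k. of_nat (k choose j) * (deriv ^^ j) rGamma 0 *
                                (of_real (ln (real n)) + eval_fps zeta_fps 1) ^ (k - j)))
             \<le> C * 2 ^ k * fact k / sqrt (real n)"
    using power_nth_asymptotics[OF h] by blast
  show ?thesis
  proof (rule that[OF C])
    fix k N :: nat assume "k > 0" "N > 0"
    have "fps_nth (log_fps + zeta_fps) a = of_real (zeta (2 * real a) / real a)" for a
      by (simp add: log_fps_def zeta_fps_def diff_divide_distrib)
    hence "fps_nth ((log_fps + zeta_fps) ^ k) N = of_real (Z k N)"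
      using \<open>k > 0\<close> by (simp add: fps_power_nth_compositions Z_def del: fps_add_nth)
    hence "complex_of_real (real N * Z k N
              - (\<Sum>j=1..k. real (k choose j) * phi j * (ln (real N) + ln 2) ^ (k - j)))
             = of_nat N * fps_nth ((log_fps + zeta_fps) ^ k) N
                  - (\<Sum>j=0..k. of_nat (k choose j) * (deriv ^^ j) rGamma 0 *
                                (of_real (ln (real N)) + eval_fps zeta_fps 1) ^ (k - j))"
      unfolding of_real_diff sum_phi_eq by (simp add: eval_fps_zeta_fps_1)
    from arg_cong[OF this, of norm] show "eps_Z k N \<le> C * 2 ^ k * fact k / sqrt (real N)"
      unfolding norm_of_real eps_Z_def using bound[OF \<open>N > 0\<close>, of k] by (simp only:)
  qed
qed

theorem proposition7p2:
  "\<exists>C::real. C > 1 \<and>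
     (\<forall>k N :: nat. k > 0 \<longrightarrow> N > 0 \<longrightarrow> real k \<le> (ln (real N))\<^sup>2 \<longrightarrow>
        eps_H k N \<le> C * 2 ^ k * fact k * ln (real N) ^ 14 * real N powr (- 1 / 2) \<and>
        eps_Z k N \<le> C * 2 ^ k * fact k * ln (real N) ^ 14 * real N powr (- 1 / 2))"
proof -
  obtain A where A: "A > 0"
    "\<And>k N. k > 0 \<Longrightarrow> N > 0 \<Longrightarrow> eps_H k N \<le> A * 2 ^ k * fact k / sqrt (real N)"
    by (rule eps_H_bound) (rule that)
  obtain B where B: "B > 0"
    "\<And>k N. k > 0 \<Longrightarrow> N > 0 \<Longrightarrow> eps_Z k N \<le> B * 2 ^ k * fact k / sqrt (real N)"
    by (rule eps_Z_bound) (rule that)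
  \<comment> \<open>The summand 1 ensures C > 1; since A and B are positive, C dominates
    both.\<close>
  define C where "C = 1 + A + B"
  have "eps_H k N \<le> C * 2 ^ k * fact k * ln (real N) ^ 14 * real N powr (- 1 / 2) \<and>
        eps_Z k N \<le> C * 2 ^ k * fact k * ln (real N) ^ 14 * real N powr (- 1 / 2)"
    if k: "k > 0" and N: "N > 0" and kN: "real k \<le> (ln (real N))\<^sup>2" for k N :: nat
  proof -
    \<comment> \<open>Since k >= 1, the assumption on k forces log N >= 1, so inserting the factor
      (log N)^14 can only enlarge the bound.\<close>
    have "(1::real)\<^sup>2 \<le> (ln (real N))\<^sup>2" using k kN by simp
    hence "ln (real N) \<ge> 1" by (rule power2_le_imp_le) (use N in simp)
    hence ln: "ln (real N) ^ 14 \<ge> 1" by (rule one_le_power)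
    have powr: "real N powr (- 1 / 2) = 1 / sqrt (real N)"
      using N by (simp add: powr_minus_divide powr_half_sqrt)
    have "c * 2 ^ k * fact k / sqrt (real N) \<le> C * 2 ^ k * fact k * ln (real N) ^ 14 * real N powr (- 1 / 2)"
      if "c \<le> C" for c
    proof -
      define y where "y = C * 2 ^ k * fact k / sqrt (real N)"
      have "y \<ge> 0"
        unfolding y_def C_def using A(1) B(1) by simp
      have "c * 2 ^ k * fact k / sqrt (real N) \<le> y"
        unfolding y_def using that by (intro divide_right_mono mult_right_mono) auto
      also have "y \<le> y * ln (real N) ^ 14"
        using mult_left_mono[OF ln \<open>y \<ge> 0\<close>] by simp
      finally show ?thesis
        unfolding y_def powr by (simp only: times_divide_eq_left times_divide_eq_right mult_1_right)
    qed
    note bound = this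
    have "A \<le> C" "B \<le> C" using A(1) B(1) by (simp_all add: C_def)
    thus ?thesis
      by (intro conjI order_trans[OF A(2)[OF k N] bound] order_trans[OF B(2)[OF k N] bound])
  qed
  moreover have "C > 1" using A(1) B(1) by (simp add: C_def)
  ultimately show ?thesis by blast
qed

end
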